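(* Let $a,b,m,N,M\in\mathbb{N}$ with $b\mid a$, $m=a+b$ and $N\le M$. For $j\ge0$ set $A_j:=a+jm$ and $B_j:=b+jm$, and let $$\mathcal{E}_{N,M}:=\{1,2,\ldots,N+M-1\}\setminus\{1,3,5,\ldots,2N-1\}.$$ Then $$g_{a,b,m}(N,M;q)=\prod_{j=0}^{N-1}R_{A_j,B_j}(q)\;\times\prod_{r\in\mathcal{E}_{N,M}}(1+q^{rm})\;\prod_{j=N}^{M-1}\frac{1}{1-q^{B_j}}.$$
   Context: $\mathbb{N}$ is the set of positive integers. Notation: $(z;q)_n=\prod_{i=0}^{n-1}(1-zq^i)$. For $a,b,m,N,M\in\mathbb{N}$, $$g_{a,b,m}(N,M;q):=\frac{(-q^m;q^m)_{N+M-1}}{(-q^a;q^m)_N\,(q^b;q^m)_M}.$$ For $A,B\in\mathbb{N}$, $$R_{A,B}(q):=\frac{1+q^{A+B}}{(1+q^A)(1-q^B)}.$$ Quotients are expanded as formal power series in $q$; empty products equal $1$. *)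

theory Defs
  imports "HOL-Computational_Algebra.Formal_Power_Series"
begin

definition qpoch :: "'a::comm_ring_1 \<Rightarrow> 'a \<Rightarrow> nat \<Rightarrow> 'a" where
  "qpoch z q n = (\<Prod>i<n. 1 - z * q ^ i)"

text \<open>
  Quotients are taken in the ring of formal power series. For positive \<open>a\<close>, \<open>b\<close>, \<open>m\<close> (resp. \<open>A\<close>, \<open>B\<close>)
  and \<open>q = fps_X\<close> the denominators below have constant coefficient 1, hence are units, so the
  library's division is the expansion of the quotient as a power series.
\<close>

definition g_quot :: "nat \<Rightarrow> nat \<Rightarrow> nat \<Rightarrow> nat \<Rightarrow> nat \<Rightarrow> 'a::field fps \<Rightarrow> 'a fps" where
  "g_quot a b m N M q =
     qpoch (- (q ^ m)) (q ^ m) (N + M - 1) /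
     (qpoch (- (q ^ a)) (q ^ m) N * qpoch (q ^ b) (q ^ m) M)"

definition R_quot :: "nat \<Rightarrow> nat \<Rightarrow> 'a::field fps \<Rightarrow> 'a fps" where
  "R_quot A B q = (1 + q ^ (A + B)) / ((1 + q ^ A) * (1 - q ^ B))"

definition E_set :: "nat \<Rightarrow> nat \<Rightarrow> nat set" where
  "E_set N M = {1..N + M - 1} - {r. odd r \<and> r \<le> 2 * N - 1}"

end

theory Submission
  imports Defs
begin

unbundle fps_syntax

text \<open>
  Since \<open>A\<^sub>j + B\<^sub>j = (2j + 1)m\<close>, the numerators of the factors \<open>R\<close> supply exactly the factors
  \<open>1 + q\<^sup>r\<^sup>m\<close> with \<open>r\<close> odd, \<open>r \<le> 2N - 1\<close>; as \<open>N \<le> M\<close>, all of these occur in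
  \<open>(-q\<^sup>m; q\<^sup>m)\<close> of length \<open>N + M - 1\<close>, and the remaining indices form \<open>\<E>\<close>.
\<close>

lemma fps_nth_0_prod:
  fixes f :: "'b \<Rightarrow> 'a::comm_ring_1 fps"
  shows "prod f S $ 0 = (\<Prod>i\<in>S. f i $ 0)"
  by (induction S rule: infinite_finite_induct) simp_all

lemma qpoch_power:
  "qpoch (q ^ c) (q ^ m) n = (\<Prod>j<n. 1 - q ^ (c + j * m))"
  by (simp add: qpoch_def power_add power_mult mult.commute flip: power_mult)

lemma qpoch_minus_power:
  "qpoch (- (q ^ c)) (q ^ m) n = (\<Prod>j<n. 1 + q ^ (c + j * m))"
  by (simp add: qpoch_def power_add power_mult mult.commute flip: power_mult)

lemma prod_odd_E_set:
  fixes f :: "nat \<Rightarrow> 'a::comm_monoid_mult"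
  assumes "N > 0" "N \<le> M"
  shows "(\<Prod>j<N. f (2 * j + 1)) * prod f (E_set N M) = (\<Prod>r=1..N + M - 1. f r)"
proof -
  let ?O = "(\<lambda>j. 2 * j + 1) ` {..<N}"
  have E: "E_set N M = {1..N + M - 1} - ?O"
    unfolding E_set_def by (auto elim!: oddE)
  \<comment> \<open>The largest element of \<open>?O\<close> is \<open>2 * N - 1\<close>, which is
    at most \<open>N + M - 1\<close> because \<open>N \<le> M\<close>.\<close>
  have sub: "?O \<subseteq> {1..N + M - 1}"
    using assms by auto
  have "(\<Prod>j<N. f (2 * j + 1)) = prod f ?O"
    by (subst prod.reindex) (auto simp: inj_on_def)
  then show ?thesis
    using prod.subset_diff[OF sub, of f] by (simp add: E mult.commute)
qed

theorem proposition2p4: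
  fixes a b m N M :: nat and q :: "rat fps" and A B :: "nat \<Rightarrow> nat"
  defines "q \<equiv> fps_X"
  defines "A \<equiv> (\<lambda>j. a + j * m)"
  defines "B \<equiv> (\<lambda>j. b + j * m)"
  assumes "a > 0" "b > 0" "m > 0" "N > 0" "M > 0"
    and "b dvd a" and "m = a + b" and "N \<le> M"
  shows "g_quot a b m N M q =
    (\<Prod>j=0..<N. R_quot (A j) (B j) q) *
    (\<Prod>r\<in>E_set N M. 1 + q ^ (r * m)) *
    (\<Prod>j=N..<M. 1 / (1 - q ^ B j))"
proof -
  \<comment> \<open>The exponents are positive, so \<open>1 + q ^ A j\<close> and
    \<open>1 - q ^ B j\<close> have constant coefficient 1; as units, they turn division into
    multiplication by \<open>inverse\<close>.\<close>
  have A0: "q ^ A j $ 0 = 0" and B0: "q ^ B j $ 0 = 0" for j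
    using \<open>a > 0\<close> \<open>b > 0\<close> by (simp_all add: q_def A_def B_def)
  have AB: "A j + B j = (2 * j + 1) * m" for j
    using \<open>m = a + b\<close> by (simp add: A_def B_def algebra_simps)
  have R: "R_quot (A j) (B j) q =
      (1 + q ^ ((2 * j + 1) * m)) * (inverse (1 + q ^ A j) * inverse (1 - q ^ B j))" for j
    unfolding R_quot_def AB by (subst fps_divide_unit) (simp_all add: A0 B0 fps_inverse_mult)
  have inv: "1 / (1 - q ^ B j) = inverse (1 - q ^ B j)" for j
    by (subst fps_divide_unit) (simp_all add: B0)
  have num: "qpoch (- (q ^ m)) (q ^ m) (N + M - 1) = (\<Prod>r=1..N + M - 1. 1 + q ^ (r * m))"
    \<comment> \<open>The factor with index \<open>j\<close> has exponent \<open>m + j * m\<close>,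
      hence the shift \<open>r = Suc j\<close>.\<close>
    unfolding qpoch_minus_power by (rule prod.reindex_bij_witness[of _ "\<lambda>r. r - 1" Suc]) auto
  have den: "((\<Prod>j<N. 1 + q ^ A j) * (\<Prod>j<M. 1 - q ^ B j)) $ 0 = 1"
    by (simp add: fps_nth_0_prod A0 B0)
  have "g_quot a b m N M q = (\<Prod>r=1..N + M - 1. 1 + q ^ (r * m)) *
      ((\<Prod>j<N. inverse (1 + q ^ A j)) * (\<Prod>j<M. inverse (1 - q ^ B j)))"
    \<comment> \<open>\<open>num\<close> comes first, since \<open>qpoch_minus_power\<close> would
      also rewrite the numerator.\<close>
    unfolding g_quot_def num unfolding qpoch_minus_power qpoch_power A_def[symmetric] B_def[symmetric]
    using den by (simp add: fps_divide_unit fps_inverse_mult inverse_prod_fps A_def B_def)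
  \<comment> \<open>The factors with \<open>j < N\<close> belong to the \<open>R_quot\<close> terms;
    the others form the last product of the claim.\<close>
  also have "(\<Prod>j<M. inverse (1 - q ^ B j)) =
      (\<Prod>j<N. inverse (1 - q ^ B j)) * (\<Prod>j=N..<M. inverse (1 - q ^ B j))"
    using \<open>N \<le> M\<close> by (simp add: lessThan_atLeast0 prod.atLeastLessThan_concat)
  also have "(\<Prod>r=1..N + M - 1. 1 + q ^ (r * m)) =
      (\<Prod>j<N. 1 + q ^ ((2 * j + 1) * m)) * (\<Prod>r\<in>E_set N M. 1 + q ^ (r * m))"
    using prod_odd_E_set[OF \<open>N > 0\<close> \<open>N \<le> M\<close>, of "\<lambda>r. 1 + q ^ (r * m)"] by simp
  finally show ?thesis
    unfolding R inv prod.distrib lessThan_atLeast0 by (simp only: mult_ac)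
qed

end
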